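(* For finite posets $\mathcal A=(A,\le_A)$, $\mathcal B=(B,\le_B)$ with $A,B$ disjoint and $a\in A$, let $\mathcal A\bullet_a\mathcal B$ be the set $A\sqcup_a B:=(A\setminus\{a\})\sqcup B$ with the relation $\le$ defined by: $x\le y$ if and only if (i) $x,y\in B$ and $x\le_B y$, or (ii) $x,y\in A\setminus\{a\}$ and $x\le_A y$, or (iii) $x\in A\setminus\{a\}$, $y\in B$ and $x\le_A a$, or (iv) $x\in B$, $y\in A\setminus\{a\}$ and $a\le_A y$. (This is a partial order.) Then the partial compositions $\bullet_a$ endow the set species of finite posets with a structure of operad.
   Context: The set species of finite posets assigns to each finite set $A$ the set of all partial orders on $A$; bijections act by relabelling. An operad structure on a set species $\mathbb P$, in terms of partial compositions, is a family of maps $\bullet_a:\mathbb P_A\times\mathbb P_B\to\mathbb P_{A\sqcup_a B}$ ($A,B$ disjoint finite sets, $a\in A$), natural with respect to relabelling bijections, such that for $X\in\mathbb P_A$, $Y\in\mathbb P_B$, $Z\in\mathbb P_C$ with $A,B,C$ pairwise disjoint: (parallel associativity) $(X\bullet_aY)\bullet_{a'}Z=(X\bullet_{a'}Z)\bullet_aY$ for $a\ne a'$ in $A$; (nested associativity) $(X\bullet_aY)\bullet_bZ=X\bullet_a(Y\bullet_bZ)$ for $a\in A$, $b\in B$; together with units in $\mathbb P_{\{a\}}$ (here the one-point posets): $1_{\{a\}}\bullet_aY=Y$ and $X\bullet_a1_{\{b\}}$ is $X$ with $a$ relabelled $b$. *)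

theory Defs
  imports Main
begin

text \<open>
  A set species on the finite subsets of the type \<open>'a\<close>. Bijections \<open>\<sigma>\<close> between finite sets are
  represented by total functions that are bijective on the source \<open>A\<close>, with target \<open>\<sigma> ` A\<close>; hence
  the axiom \<open>transport_cong\<close>, by which only the values of \<open>\<sigma>\<close> on \<open>A\<close> matter.
\<close>

locale set_species =
  fixes P :: "'a set \<Rightarrow> 'p set"
    and transport :: "'a set \<Rightarrow> ('a \<Rightarrow> 'a) \<Rightarrow> 'p \<Rightarrow> 'p"
  assumes transport_closed:
      "\<lbrakk>finite A; bij_betw \<sigma> A B; X \<in> P A\<rbrakk> \<Longrightarrow> transport A \<sigma> X \<in> P B"
    and transport_cong:
      "\<lbrakk>finite A; inj_on \<sigma> A; X \<in> P A; \<And>x. x \<in> A \<Longrightarrow> \<sigma> x = \<sigma>' x\<rbrakk>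
        \<Longrightarrow> transport A \<sigma> X = transport A \<sigma>' X"
    and transport_id:
      "\<lbrakk>finite A; X \<in> P A\<rbrakk> \<Longrightarrow> transport A id X = X"
    and transport_comp:
      "\<lbrakk>finite A; bij_betw \<sigma> A B; bij_betw \<tau> B C; X \<in> P A\<rbrakk>
        \<Longrightarrow> transport A (\<tau> \<circ> \<sigma>) X = transport B \<tau> (transport A \<sigma> X)"

definition subst_set :: "'a set \<Rightarrow> 'a \<Rightarrow> 'a set \<Rightarrow> 'a set" where
  "subst_set A a B = (A - {a}) \<union> B"

text \<open>
  \<open>pcomp A B a X Y\<close> is the partial composition \<open>X \<bullet>\<^sub>a Y\<close> for \<open>X \<in> P A\<close>, \<open>Y \<in> P B\<close>; the base sets are
  explicit arguments because the values of a species on different sets may overlap.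
  In \<open>pcomp_natural\<close>, \<open>override_on \<sigma> \<tau> B\<close> is the bijection induced by \<open>\<sigma>\<close> and \<open>\<tau>\<close>: it acts as
  \<open>\<tau>\<close> on \<open>B\<close> and as \<open>\<sigma>\<close> on \<open>A - {a}\<close>. In \<open>unit_right\<close>, \<open>id(a := b)\<close> relabels \<open>a\<close> as \<open>b\<close>.
\<close>

locale set_operad = set_species P transport
  for P :: "'a set \<Rightarrow> 'p set"
    and transport :: "'a set \<Rightarrow> ('a \<Rightarrow> 'a) \<Rightarrow> 'p \<Rightarrow> 'p" +
  fixes pcomp :: "'a set \<Rightarrow> 'a set \<Rightarrow> 'a \<Rightarrow> 'p \<Rightarrow> 'p \<Rightarrow> 'p"
    and unit :: "'a \<Rightarrow> 'p"
  assumes pcomp_closed: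
      "\<lbrakk>finite A; finite B; A \<inter> B = {}; a \<in> A; X \<in> P A; Y \<in> P B\<rbrakk>
        \<Longrightarrow> pcomp A B a X Y \<in> P (subst_set A a B)"
    and pcomp_natural:
      "\<lbrakk>finite A; finite B; A \<inter> B = {}; A' \<inter> B' = {}; a \<in> A;
        bij_betw \<sigma> A A'; bij_betw \<tau> B B'; X \<in> P A; Y \<in> P B\<rbrakk>
        \<Longrightarrow> transport (subst_set A a B) (override_on \<sigma> \<tau> B) (pcomp A B a X Y)
          = pcomp A' B' (\<sigma> a) (transport A \<sigma> X) (transport B \<tau> Y)"
    and parallel_assoc:
      "\<lbrakk>finite A; finite B; finite C; A \<inter> B = {}; A \<inter> C = {}; B \<inter> C = {};
        a \<in> A; a' \<in> A; a \<noteq> a'; X \<in> P A; Y \<in> P B; Z \<in> P C\<rbrakk>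
        \<Longrightarrow> pcomp (subst_set A a B) C a' (pcomp A B a X Y) Z
          = pcomp (subst_set A a' C) B a (pcomp A C a' X Z) Y"
    and nested_assoc:
      "\<lbrakk>finite A; finite B; finite C; A \<inter> B = {}; A \<inter> C = {}; B \<inter> C = {};
        a \<in> A; b \<in> B; X \<in> P A; Y \<in> P B; Z \<in> P C\<rbrakk>
        \<Longrightarrow> pcomp (subst_set A a B) C b (pcomp A B a X Y) Z
          = pcomp A (subst_set B b C) a X (pcomp B C b Y Z)"
    and unit_closed:
      "unit a \<in> P {a}"
    and unit_left:
      "\<lbrakk>finite B; a \<notin> B; Y \<in> P B\<rbrakk> \<Longrightarrow> pcomp {a} B a (unit a) Y = Y"
    and unit_right:
      "\<lbrakk>finite A; a \<in> A; b \<notin> A; X \<in> P A\<rbrakk>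
        \<Longrightarrow> pcomp A {b} a X (unit b) = transport A (id(a := b)) X"

definition posets :: "'a set \<Rightarrow> 'a rel set" where
  "posets A = {r. partial_order_on A r}"

definition relabel :: "'a set \<Rightarrow> ('a \<Rightarrow> 'a) \<Rightarrow> 'a rel \<Rightarrow> 'a rel" where
  "relabel A \<sigma> r = {(\<sigma> x, \<sigma> y) | x y. x \<in> A \<and> y \<in> A \<and> (x, y) \<in> r}"

definition poset_comp :: "'a set \<Rightarrow> 'a set \<Rightarrow> 'a \<Rightarrow> 'a rel \<Rightarrow> 'a rel \<Rightarrow> 'a rel" where
  "poset_comp A B a r s = {(x, y).
      (x \<in> B \<and> y \<in> B \<and> (x, y) \<in> s) \<or>
      (x \<in> A - {a} \<and> y \<in> A - {a} \<and> (x, y) \<in> r) \<or>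
      (x \<in> A - {a} \<and> y \<in> B \<and> (x, a) \<in> r) \<or>
      (x \<in> B \<and> y \<in> A - {a} \<and> (a, y) \<in> r)}"

definition one_point_poset :: "'a \<Rightarrow> 'a rel" where
  "one_point_poset a = {(a, a)}"

end

theory Submission
  imports Defs
begin

text \<open>Let \<open>p\<close> be the map from \<open>subst_set A a B\<close> to \<open>A\<close>
  that collapses \<open>B\<close> to \<open>a\<close> and fixes all other points. In the composite,
  two points of \<open>B\<close> are compared by the order of \<open>B\<close>, and every other pair
  \<open>x\<close>, \<open>y\<close> is compared as \<open>p x\<close> and \<open>p y\<close> in
  \<open>A\<close>. So the composite puts \<open>B\<close> as a block in the place of
  \<open>a\<close>: points outside the block see only \<open>a\<close>.

  That this is a partial order is \<open>poset_comp_posets\<close>. Associativity holds because,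
  after two insertions, a pair is compared in the smallest inserted block containing both points (in
  \<open>A\<close> if there is none), each point being replaced by the point whose place its
  sub-block took. This rule does not depend on the order of the insertions, whether the blocks lie
  side by side (\<open>poset_comp_parallel\<close>) or one inside the other
  (\<open>poset_comp_nested\<close>). Naturality (\<open>relabel_poset_comp\<close>) holds because
  the rule mentions only membership and the given orders, which bijections preserve and
  reflect.\<close>

lemma in_posets_iff:
  "r \<in> posets A \<longleftrightarrow>
    (\<forall>x y. (x, y) \<in> r \<longrightarrow> x \<in> A \<and> y \<in> A) \<and>
    (\<forall>x\<in>A. (x, x) \<in> r) \<and>
    (\<forall>x y z. (x, y) \<in> r \<longrightarrow> (y, z) \<in> r \<longrightarrow> (x, z) \<in> r) \<and>
    (\<forall>x y. (x, y) \<in> r \<longrightarrow> (y, x) \<in> r \<longrightarrow> x = y)"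
  unfolding posets_def partial_order_on_def preorder_on_def refl_on_def trans_def antisym_def
    subset_iff split_paired_All mem_Collect_eq mem_Times_iff fst_conv snd_conv
  by argo

lemma posets_fieldD:
  assumes "r \<in> posets A" "(x, y) \<in> r"
  shows "x \<in> A" "y \<in> A"
  using assms by (auto simp: in_posets_iff)

lemma posets_refl: "r \<in> posets A \<Longrightarrow> x \<in> A \<Longrightarrow> (x, x) \<in> r"
  by (simp add: in_posets_iff)

lemma posets_trans: "r \<in> posets A \<Longrightarrow> (x, y) \<in> r \<Longrightarrow> (y, z) \<in> r \<Longrightarrow> (x, z) \<in> r"
  unfolding in_posets_iff by blast

lemma posets_antisym: "r \<in> posets A \<Longrightarrow> (x, y) \<in> r \<Longrightarrow> (y, x) \<in> r \<Longrightarrow> x = y"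
  unfolding in_posets_iff by blast

lemma poset_comp_iff:
  "(x, y) \<in> poset_comp A B a r s \<longleftrightarrow>
    x \<in> B \<and> y \<in> B \<and> (x, y) \<in> s \<or>
    x \<in> A - {a} \<and> y \<in> A - {a} \<and> (x, y) \<in> r \<or>
    x \<in> A - {a} \<and> y \<in> B \<and> (x, a) \<in> r \<or>
    x \<in> B \<and> y \<in> A - {a} \<and> (a, y) \<in> r"
  by (simp add: poset_comp_def)

lemma relabel_iff:
  "(u, v) \<in> relabel A \<sigma> r \<longleftrightarrow> (\<exists>x\<in>A. \<exists>y\<in>A. u = \<sigma> x \<and> v = \<sigma> y \<and> (x, y) \<in> r)"
  by (auto simp: relabel_def)

text \<open>Injectivity makes relabelling reflect the relation as well as preserve it. Through this,
  \<open>relabel_posets\<close> and \<open>relabel_poset_comp\<close> pull their claims back to the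
  source.\<close>

lemma relabel_image_iff:
  assumes "inj_on \<sigma> A" "x \<in> A" "y \<in> A"
  shows "(\<sigma> x, \<sigma> y) \<in> relabel A \<sigma> r \<longleftrightarrow> (x, y) \<in> r"
  using assms by (auto simp: relabel_iff dest: inj_onD)

lemma relabel_posets:
  assumes "bij_betw \<sigma> A B" "r \<in> posets A"
  shows "relabel A \<sigma> r \<in> posets B"
proof -
  have inj: "inj_on \<sigma> A" and B: "B = \<sigma> ` A"
    using assms(1) by (auto simp: bij_betw_def)
  have field: "u \<in> B \<and> v \<in> B" if "(u, v) \<in> relabel A \<sigma> r" for u v
    using that by (auto simp: relabel_iff B)
  show ?thesis
    unfolding in_posets_iff
  proof (intro conjI allI impI ballI)
    fix u v w assume "(u, v) \<in> relabel A \<sigma> r" "(v, w) \<in> relabel A \<sigma> r"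
    \<comment> \<open>Preimages are chosen for points rather than for pairs, so that the same
      \<open>y\<close> serves both pairs containing \<open>v\<close>.\<close>
    moreover from this obtain x y z where "x \<in> A" "y \<in> A" "z \<in> A" "u = \<sigma> x" "v = \<sigma> y" "w = \<sigma> z"
      using field unfolding B by blast
    ultimately show "(u, w) \<in> relabel A \<sigma> r"
      using posets_trans[OF assms(2)] by (auto simp: relabel_image_iff[OF inj])
  next
    fix u v assume "(u, v) \<in> relabel A \<sigma> r" "(v, u) \<in> relabel A \<sigma> r"
    moreover from this obtain x y where "x \<in> A" "y \<in> A" "u = \<sigma> x" "v = \<sigma> y"
      using field unfolding B by blast
    ultimately show "u = v"
      using posets_antisym[OF assms(2)] by (auto simp: relabel_image_iff[OF inj])
  qed (use field posets_refl[OF assms(2)] in \<open>auto simp: B relabel_image_iff[OF inj]\<close>)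
qed

lemma set_species_posets: "set_species (posets :: 'a set \<Rightarrow> 'a rel set) relabel"
proof
  fix A :: "'a set" and \<sigma> \<sigma>' :: "'a \<Rightarrow> 'a" and r
  assume "\<And>x. x \<in> A \<Longrightarrow> \<sigma> x = \<sigma>' x"
  then show "relabel A \<sigma> r = relabel A \<sigma>' r"
    by (auto simp: relabel_iff)
next
  fix A :: "'a set" and r
  assume "r \<in> posets A"
  then show "relabel A id r = r"
    by (auto simp: relabel_iff dest: posets_fieldD)
next
  fix A B C :: "'a set" and \<sigma> \<tau> :: "'a \<Rightarrow> 'a" and r
  assume "bij_betw \<sigma> A B"
  then show "relabel A (\<tau> \<circ> \<sigma>) r = relabel B \<tau> (relabel A \<sigma> r)"
    by (fastforce simp: relabel_iff bij_betw_def)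
qed (rule relabel_posets)

lemma poset_comp_posets:
  assumes "A \<inter> B = {}" "a \<in> A" "r \<in> posets A" "s \<in> posets B"
  shows "poset_comp A B a r s \<in> posets (subst_set A a B)"
proof -
  note r = assms(3) and s = assms(4)
  have disj: "x \<notin> B" if "x \<in> A" for x
    using that assms(1) by auto
  show ?thesis
    unfolding in_posets_iff
  proof (intro conjI allI impI ballI)
    fix x y z assume "(x, y) \<in> poset_comp A B a r s" "(y, z) \<in> poset_comp A B a r s"
    \<comment> \<open>The delicate case has \<open>x\<close> and \<open>z\<close> in
      \<open>B\<close> but \<open>y\<close> outside: then a \<le> y \<le> a in \<open>A\<close>, and
      antisymmetry forces \<open>y = a\<close>, which has been removed. In the other mixed cases,
      transitivity in \<open>A\<close> is applied with \<open>a\<close> in place of the points of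
      \<open>B\<close>.\<close>
    then show "(x, z) \<in> poset_comp A B a r s"
      using posets_trans[OF s, of x y z] posets_trans[OF r, of x y z] posets_trans[OF r, of x a z]
        posets_trans[OF r, of x y a] posets_trans[OF r, of a y z] posets_antisym[OF r, of a y]
        disj[of x] disj[of y] disj[of z]
      unfolding poset_comp_iff
      by (cases "x \<in> A"; cases "y \<in> A"; cases "z \<in> A") auto
  next
    fix x y assume "(x, y) \<in> poset_comp A B a r s" "(y, x) \<in> poset_comp A B a r s"
    \<comment> \<open>A mixed pair cannot be related in both directions: its point in
      \<open>A\<close> would equal the removed \<open>a\<close>.\<close>
    then show "x = y"
      using posets_antisym[OF s, of x y] posets_antisym[OF r, of x y] posets_antisym[OF r, of x a]
        posets_antisym[OF r, of y a] disj[of x] disj[of y]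
      unfolding poset_comp_iff
      by (cases "x \<in> A"; cases "y \<in> A") auto
  qed (use posets_refl[OF r] posets_refl[OF s] in \<open>auto simp: poset_comp_iff subst_set_def\<close>)
qed

text \<open>The glued map is injective, since its two pieces are injective and land in the disjoint
  sets \<open>A'\<close> and \<open>B'\<close>. It carries each clause of the composite to the same
  clause for the images, with \<open>\<sigma> a\<close> as the removed point.\<close>

lemma relabel_poset_comp:
  assumes "A \<inter> B = {}" "A' \<inter> B' = {}" "a \<in> A" "bij_betw \<sigma> A A'" "bij_betw \<tau> B B'"
  shows "relabel (subst_set A a B) (override_on \<sigma> \<tau> B) (poset_comp A B a r s)
    = poset_comp A' B' (\<sigma> a) (relabel A \<sigma> r) (relabel B \<tau> s)" (is "?L = ?R")
proof -
  let ?\<rho> = "override_on \<sigma> \<tau> B" and ?S = "subst_set A a B"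
  have inj: "inj_on \<sigma> A" "inj_on \<tau> B" and A': "A' = \<sigma> ` A" and B': "B' = \<tau> ` B"
    using assms(4,5) by (auto simp: bij_betw_def)
  have \<rho>A: "?\<rho> x = \<sigma> x" "x \<notin> B" "\<sigma> x \<in> A'" "\<sigma> x \<notin> B'" if "x \<in> A" for x
    using that assms(1,2) by (auto simp: A' override_on_def)
  have \<rho>B: "?\<rho> x = \<tau> x" "x \<notin> A" "\<tau> x \<in> B'" "\<tau> x \<notin> A'" if "x \<in> B" for x
    using that assms(1,2) by (auto simp: B' override_on_def)
  have eq: "\<sigma> x = \<sigma> a \<longleftrightarrow> x = a" if "x \<in> A" for x
    using that inj(1) assms(3) by (auto dest: inj_onD)
  have "?\<rho> ` (A - {a}) = \<sigma> ` (A - {a})" "?\<rho> ` B = \<tau> ` B"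
    using \<rho>A \<rho>B by (auto intro!: image_cong)
  moreover have "\<sigma> ` (A - {a}) = A' - {\<sigma> a}"
    using eq by (auto simp: A')
  ultimately have image: "?\<rho> ` ?S = subst_set A' (\<sigma> a) B'"
    unfolding subst_set_def image_Un B' by simp
  have "inj_on ?\<rho> (A - {a})" "inj_on ?\<rho> B"
    using inj \<rho>A \<rho>B by (simp_all add: inj_on_def)
  moreover have "?\<rho> ` (A - {a}) \<inter> ?\<rho> ` B = {}"
    using \<rho>A \<rho>B by fastforce
  ultimately have inj\<rho>: "inj_on ?\<rho> ?S"
    unfolding subst_set_def inj_on_Un by blast
  have main: "(?\<rho> x, ?\<rho> y) \<in> ?L \<longleftrightarrow> (?\<rho> x, ?\<rho> y) \<in> ?R" if "x \<in> ?S" "y \<in> ?S" for x y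
  proof -
    have x: "x \<in> A \<and> x \<noteq> a \<or> x \<in> B" and y: "y \<in> A \<and> y \<noteq> a \<or> y \<in> B"
      using that by (auto simp: subst_set_def)
    have "(?\<rho> x, ?\<rho> y) \<in> ?L \<longleftrightarrow> (x, y) \<in> poset_comp A B a r s"
      using that by (rule relabel_image_iff[OF inj\<rho>])
    with x y show ?thesis
      by (elim disjE) (simp_all add: poset_comp_iff \<rho>A \<rho>B eq assms(3)
          relabel_image_iff[OF inj(1)] relabel_image_iff[OF inj(2)])
  qed
  show ?thesis
  proof (rule set_eqI, unfold split_paired_all)
    fix u v
    \<comment> \<open>Both relations live on the image of the glued map, so agreement there, given
      by \<open>main\<close>, suffices.\<close>
    have "u \<in> ?\<rho> ` ?S \<and> v \<in> ?\<rho> ` ?S" if "(u, v) \<in> ?L"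
      using that by (auto simp: relabel_iff)
    moreover have "u \<in> ?\<rho> ` ?S \<and> v \<in> ?\<rho> ` ?S" if "(u, v) \<in> ?R"
      using that unfolding image by (auto simp: poset_comp_iff subst_set_def)
    moreover have "(u, v) \<in> ?L \<longleftrightarrow> (u, v) \<in> ?R" if "u \<in> ?\<rho> ` ?S" "v \<in> ?\<rho> ` ?S"
      using that main by (elim imageE) (simp only:)
    ultimately show "(u, v) \<in> ?L \<longleftrightarrow> (u, v) \<in> ?R"
      by argo
  qed
qed

text \<open>The pairs that mix the two insertions are those between \<open>B\<close> and
  \<open>C\<close>: since a \<noteq> a', both sides compare them as \<open>a\<close> with
  \<open>a'\<close> in \<open>r\<close>.\<close>

lemma poset_comp_parallel:
  assumes "A \<inter> B = {}" "A \<inter> C = {}" "B \<inter> C = {}" "a \<in> A" "a' \<in> A" "a \<noteq> a'"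
  shows "poset_comp (subst_set A a B) C a' (poset_comp A B a r s) t
    = poset_comp (subst_set A a' C) B a (poset_comp A C a' r t) s"
proof -
  have disj: "x \<notin> B" "x \<notin> C" if "x \<in> A" for x
    using that assms(1,2) by auto
  have disj': "x \<notin> C" if "x \<in> B" for x
    using that assms(3) by auto
  show ?thesis (is "?L = ?R")
  proof (rule set_eqI, unfold split_paired_all)
    fix x y
    show "(x, y) \<in> ?L \<longleftrightarrow> (x, y) \<in> ?R"
      using assms(4-) disj[of x] disj[of y] disj'[of x] disj'[of y] disj[of a] disj[of a']
      unfolding poset_comp_iff subst_set_def
      by (cases "x \<in> A"; cases "x \<in> B"; cases "x \<in> C"; cases "y \<in> A"; cases "y \<in> B"; cases "y \<in> C")
        auto
  qed
qed

text \<open>On both sides, points of \<open>C\<close> are compared with \<open>B - {b}\<close>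
  through \<open>b\<close> in \<open>s\<close>, and with \<open>A - {a}\<close> through
  \<open>a\<close> in \<open>r\<close>. On the left the latter takes two replacements,
  \<open>b\<close> and then \<open>a\<close>; on the right only one.\<close>

lemma poset_comp_nested:
  assumes "A \<inter> B = {}" "A \<inter> C = {}" "B \<inter> C = {}" "a \<in> A" "b \<in> B"
  shows "poset_comp (subst_set A a B) C b (poset_comp A B a r s) t
    = poset_comp A (subst_set B b C) a r (poset_comp B C b s t)"
proof -
  have disj: "x \<notin> B" "x \<notin> C" if "x \<in> A" for x
    using that assms(1,2) by auto
  have disj': "x \<notin> C" if "x \<in> B" for x
    using that assms(3) by auto
  \<comment> \<open>As \<open>b\<close> is not in \<open>A\<close>, removing it from the composite
    of \<open>A\<close> and \<open>B\<close> affects only the part coming from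
    \<open>B\<close>.\<close>
  have b: "b \<notin> A" "b \<notin> C"
    using assms(1,3,5) by auto
  show ?thesis (is "?L = ?R")
  proof (rule set_eqI, unfold split_paired_all)
    fix x y
    show "(x, y) \<in> ?L \<longleftrightarrow> (x, y) \<in> ?R"
      using assms(4-) disj[of x] disj[of y] disj'[of x] disj'[of y] disj[of a] b
      unfolding poset_comp_iff subst_set_def
      by (cases "x \<in> A"; cases "x \<in> B"; cases "x \<in> C"; cases "y \<in> A"; cases "y \<in> B"; cases "y \<in> C")
        auto
  qed
qed

lemma one_point_poset_posets: "one_point_poset a \<in> posets {a}"
  by (auto simp: one_point_poset_def in_posets_iff)

text \<open>Nothing is left of \<open>{a}\<close> once \<open>a\<close> is removed, so only the
  clause inside \<open>B\<close> survives.\<close>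

lemma poset_comp_unit_left:
  assumes "s \<in> posets B"
  shows "poset_comp {a} B a r s = s"
  using assms by (auto simp: poset_comp_iff dest: posets_fieldD)

lemma poset_comp_unit_right:
  assumes "a \<in> A" "b \<notin> A" "r \<in> posets A"
  shows "poset_comp A {b} a r (one_point_poset b) = relabel A (id(a := b)) r"
proof -
  \<comment> \<open>Separating the preimage \<open>a\<close> of \<open>b\<close> from the others
    turns the pairs of the relabelled relation into the four clauses of the composite; the pair
    \<open>(b, b)\<close> comes from reflexivity at \<open>a\<close>.\<close>
  have split: "(\<exists>x\<in>A. Q x) \<longleftrightarrow> Q a \<or> (\<exists>x\<in>A - {a}. Q x)" for Q
    using assms(1) by auto
  show ?thesis
    using assms(2) posets_refl[OF assms(3,1)]
    by (auto simp: poset_comp_iff relabel_iff one_point_poset_def split)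
qed

theorem theorem6:
  shows "set_operad (posets :: 'a set \<Rightarrow> 'a rel set) relabel poset_comp one_point_poset"
proof (rule set_operad.intro[OF set_species_posets], rule set_operad_axioms.intro, goal_cases)
  case 1 then show ?case by (intro poset_comp_posets)
next
  case 2 then show ?case by (intro relabel_poset_comp)
next
  case 3 then show ?case by (intro poset_comp_parallel)
next
  case 4 then show ?case by (intro poset_comp_nested)
next
  case 5 show ?case by (rule one_point_poset_posets)
next
  case 6 then show ?case by (intro poset_comp_unit_left)
next
  case 7 then show ?case by (intro poset_comp_unit_right)
qed

end
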